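(* Let $E$ be a Dedekind $\sigma$-complete Banach lattice with order continuous norm and a weak unit $e \in E_+$, and let $\varphi \in E'_+$ be a strictly positive functional. Let $E^u$ be the universal completion of $E$ and define $$d_\varphi \colon E^u \times E^u \to [0,\infty), \qquad d_\varphi(f,g) := \varphi(|f-g| \wedge e)$$ (which is well defined because $|f-g|\wedge e \in [0,e]_{E^u} \subseteq E$). Then the following assertions hold: (i) $d_\varphi$ is a metric on $E^u$. (ii) The canonical embedding $\iota \colon E \to E^u$ is continuous with respect to the norm on $E$ and $d_\varphi$ on $E^u$. (iii) The topology generated by $d_\varphi$ is locally solid. (iv) The topology generated by $d_\varphi$ has the $\sigma$-Lebesgue property.
   Context: The norm of a Banach lattice is order continuous if $x_\alpha \downarrow 0$ implies $\|x_\alpha\| \to 0$ for each decreasing net. A vector lattice is Dedekind $\sigma$-complete if every countable non-empty subset bounded above has a supremum. An element $e \in E_+$ is a weak unit if $x \wedge e = 0$ implies $x=0$ for $x \in E_+$. $\varphi$ is strictly positive if $\varphi(x)>0$ for each $0 < x \in E_+$. The universal completion $E^u$ of an Archimedean vector lattice $E$ is the (unique up to lattice isomorphism) universally complete vector lattice (i.e. Dedekind complete, and every non-empty pairwise disjoint family of positive elements has a supremum) containing $E$ as an order dense sublattice (for each $0 < x \in E^u$ there is $y \in E$ with $0 < y \le x$). A subset $A$ of a vector lattice is solid if $|y| \le |x|$ and $x \in A$ imply $y \in A$. A linear topology on a vector lattice is locally solid if it admits a neighbourhood base of zero consisting of solid sets; it has the $\sigma$-Lebesgue property if, for every sequence,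 $x_n \downarrow 0$ implies $x_n \to 0$ in the topology. *)

theory Defs
  imports "HOL-Analysis.Analysis" "HOL-Library.Lattice_Algebras" "HOL-Library.Lub_Glb"
begin

section \<open>Vector lattices and Banach lattices\<close>

text \<open>In \<^class>\<open>lattice_ab_group_add_abs\<close> the modulus is the lattice one, \<open>\<bar>x\<bar> = sup x (- x)\<close>.\<close>

class vector_lattice = ordered_real_vector + lattice_ab_group_add_abs

class banach_lattice = banach + vector_lattice +
  assumes norm_mono_abs: "\<bar>x\<bar> \<le> \<bar>y\<bar> \<Longrightarrow> norm x \<le> norm y"

definition weak_unit :: "'a::vector_lattice \<Rightarrow> bool" where
  "weak_unit e \<longleftrightarrow> 0 \<le> e \<and> (\<forall>x\<ge>0. inf x e = 0 \<longrightarrow> x = 0)"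

definition positive_functional :: "('a::vector_lattice \<Rightarrow> real) \<Rightarrow> bool" where
  "positive_functional \<phi> \<longleftrightarrow> linear \<phi> \<and> (\<forall>x\<ge>0. 0 \<le> \<phi> x)"

definition strictly_positive :: "('a::vector_lattice \<Rightarrow> real) \<Rightarrow> bool" where
  "strictly_positive \<phi> \<longleftrightarrow> (\<forall>x>0. 0 < \<phi> x)"

definition dedekind_sigma_complete :: "'a::vector_lattice itself \<Rightarrow> bool" where
  "dedekind_sigma_complete _ \<longleftrightarrow>
     (\<forall>A::'a set. countable A \<and> A \<noteq> {} \<and> bdd_above A \<longrightarrow> (\<exists>s. isLub UNIV A s))"

definition dedekind_complete :: "'a::vector_lattice itself \<Rightarrow> bool" where
  "dedekind_complete _ \<longleftrightarrow>
     (\<forall>A::'a set. A \<noteq> {} \<and> bdd_above A \<longrightarrow> (\<exists>s. isLub UNIV A s))"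

definition universally_complete :: "'a::vector_lattice itself \<Rightarrow> bool" where
  "universally_complete _ \<longleftrightarrow> dedekind_complete TYPE('a) \<and>
     (\<forall>A::'a set. A \<noteq> {} \<and> (\<forall>x\<in>A. 0 \<le> x) \<and> pairwise (\<lambda>x y. inf x y = 0) A
        \<longrightarrow> (\<exists>s. isLub UNIV A s))"


section \<open>Order continuity of the norm\<close>

definition directed_preorder :: "'i set \<Rightarrow> ('i \<Rightarrow> 'i \<Rightarrow> bool) \<Rightarrow> bool" where
  "directed_preorder I r \<longleftrightarrow> I \<noteq> {} \<and> (\<forall>i\<in>I. r i i) \<and>
     (\<forall>i\<in>I. \<forall>j\<in>I. \<forall>k\<in>I. r i j \<and> r j k \<longrightarrow> r i k) \<and>
     (\<forall>i\<in>I. \<forall>j\<in>I. \<exists>k\<in>I. r i k \<and> r j k)"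

definition net_decreases_to_zero ::
    "'i set \<Rightarrow> ('i \<Rightarrow> 'i \<Rightarrow> bool) \<Rightarrow> ('i \<Rightarrow> 'a::vector_lattice) \<Rightarrow> bool" where
  "net_decreases_to_zero I r x \<longleftrightarrow>
     (\<forall>i\<in>I. \<forall>j\<in>I. r i j \<longrightarrow> x j \<le> x i) \<and> isGlb UNIV (x ` I) 0"

definition net_norm_tendsto_zero ::
    "'i set \<Rightarrow> ('i \<Rightarrow> 'i \<Rightarrow> bool) \<Rightarrow> ('i \<Rightarrow> 'a::real_normed_vector) \<Rightarrow> bool" where
  "net_norm_tendsto_zero I r x \<longleftrightarrow>
     (\<forall>\<epsilon>>0. \<exists>i\<in>I. \<forall>j\<in>I. r i j \<longrightarrow> norm (x j) < \<epsilon>)"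

text \<open>A definition cannot quantify over the type of indices, so nets are indexed by subsets of the
  lattice itself. This is no restriction: see \<open>order_continuous_norm_net\<close> below.\<close>

definition order_continuous_norm :: "'a::banach_lattice itself \<Rightarrow> bool" where
  "order_continuous_norm _ \<longleftrightarrow>
     (\<forall>(I::'a set) r (x::'a \<Rightarrow> 'a). directed_preorder I r \<and> net_decreases_to_zero I r x
        \<longrightarrow> net_norm_tendsto_zero I r x)"

lemma order_continuous_norm_net:
  fixes x :: "'i \<Rightarrow> 'a::banach_lattice"
  assumes "order_continuous_norm TYPE('a)"
    and dir: "directed_preorder I r" and dec: "net_decreases_to_zero I r x"
  shows "net_norm_tendsto_zero I r x"
proof -
  have "I \<noteq> {}"
    using dir unfolding directed_preorder_def by blast
  moreover have "\<exists>c\<in>x ` I. c \<le> a \<and> c \<le> b" if ab: "a \<in> x ` I" "b \<in> x ` I" for a b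
  proof -
    obtain i j where ij: "i \<in> I" "j \<in> I" "a = x i" "b = x j" using ab by blast
    then obtain k where k: "k \<in> I" "r i k" "r j k"
      using dir unfolding directed_preorder_def by blast
    then have "x k \<le> a" "x k \<le> b"
      using ij dec unfolding net_decreases_to_zero_def by blast+
    then show ?thesis using k by blast
  qed
  ultimately have "directed_preorder (x ` I) (\<lambda>a b. b \<le> a)"
    unfolding directed_preorder_def by (meson image_is_empty order_refl order_trans)
  moreover have "net_decreases_to_zero (x ` I) (\<lambda>a b. b \<le> a) (\<lambda>a. a)"
    using dec unfolding net_decreases_to_zero_def by simp
  ultimately have lim: "net_norm_tendsto_zero (x ` I) (\<lambda>a b. b \<le> a) (\<lambda>a. a)"
    using assms(1) unfolding order_continuous_norm_def by blast
  show ?thesis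
    unfolding net_norm_tendsto_zero_def
  proof (intro allI impI)
    fix \<epsilon> :: real assume "\<epsilon> > 0"
    then obtain i where "i \<in> I" "\<forall>b\<in>x ` I. b \<le> x i \<longrightarrow> norm b < \<epsilon>"
      using lim unfolding net_norm_tendsto_zero_def by blast
    then show "\<exists>i\<in>I. \<forall>j\<in>I. r i j \<longrightarrow> norm (x j) < \<epsilon>"
      using dec unfolding net_decreases_to_zero_def by blast
  qed
qed


section \<open>Universal completion\<close>

definition vector_lattice_embedding :: "('a::vector_lattice \<Rightarrow> 'b::vector_lattice) \<Rightarrow> bool" where
  "vector_lattice_embedding \<iota> \<longleftrightarrow> linear \<iota> \<and> inj \<iota> \<and>
     (\<forall>x y. \<iota> (sup x y) = sup (\<iota> x) (\<iota> y)) \<and> (\<forall>x y. \<iota> (inf x y) = inf (\<iota> x) (\<iota> y))"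

text \<open>The type \<open>'b\<close> together with the canonical embedding \<open>\<iota>\<close> is a universal completion of \<open>'a\<close>;
  it is only determined up to a lattice isomorphism.\<close>

definition universal_completion :: "('a::vector_lattice \<Rightarrow> 'b::vector_lattice) \<Rightarrow> bool" where
  "universal_completion \<iota> \<longleftrightarrow> universally_complete TYPE('b) \<and> vector_lattice_embedding \<iota> \<and>
     (\<forall>x>0. \<exists>y. 0 < \<iota> y \<and> \<iota> y \<le> x)"

text \<open>The element \<open>\<bar>f - g\<bar> \<and> e\<close> of the completion is pulled back along \<open>\<iota>\<close> before applying \<open>\<phi>\<close>.
  This is meaningful only if the order interval \<open>{0..\<iota> e}\<close> lies in the range of \<open>\<iota>\<close>.\<close>

definition d_phi ::
    "('a::vector_lattice \<Rightarrow> 'b::vector_lattice) \<Rightarrow> 'a \<Rightarrow> ('a \<Rightarrow> real) \<Rightarrow> 'b \<Rightarrow> 'b \<Rightarrow> real" where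
  "d_phi \<iota> e \<phi> f g = \<phi> (the_inv \<iota> (inf \<bar>f - g\<bar> (\<iota> e)))"


section \<open>Topologies on vector lattices\<close>

definition linear_topology :: "'a::real_vector topology \<Rightarrow> bool" where
  "linear_topology T \<longleftrightarrow> topspace T = UNIV \<and>
     continuous_map (prod_topology T T) T (\<lambda>(x, y). x + y) \<and>
     continuous_map (prod_topology euclideanreal T) T (\<lambda>(c, x). c *\<^sub>R x)"

definition solid :: "'a::vector_lattice set \<Rightarrow> bool" where
  "solid A \<longleftrightarrow> (\<forall>x y. \<bar>y\<bar> \<le> \<bar>x\<bar> \<and> x \<in> A \<longrightarrow> y \<in> A)"

definition locally_solid :: "'a::vector_lattice topology \<Rightarrow> bool" where
  "locally_solid T \<longleftrightarrow> linear_topology T \<and>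
     (\<forall>U. openin T U \<and> 0 \<in> U \<longrightarrow>
        (\<exists>V W. openin T W \<and> 0 \<in> W \<and> W \<subseteq> V \<and> V \<subseteq> U \<and> solid V))"

definition sigma_Lebesgue :: "'a::vector_lattice topology \<Rightarrow> bool" where
  "sigma_Lebesgue T \<longleftrightarrow>
     (\<forall>x::nat \<Rightarrow> 'a. decseq x \<and> isGlb UNIV (range x) 0 \<longrightarrow> limitin T x 0 sequentially)"

end

theory Submission
  imports Defs
begin

text \<open>Because \<open>\<phi>\<close> is strictly positive and, by order continuity of the norm, \<open>\<sigma>\<close>-order continuous, the
  supremum of a maximising sequence of an upward directed set is already the supremum of the set.
  Hence every element of \<open>{0..\<iota> e}\<close> is the image of the supremum of the elements of \<open>E\<close> below it.
  The function \<open>u \<mapsto> \<phi> (\<bar>u\<bar> \<and> e)\<close> is then a monotone subadditive gauge on \<open>E\<^sup>u\<close>; it vanishes only at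
  \<open>0\<close> since \<open>e\<close> is a weak unit, and it tends to \<open>0\<close> along sequences decreasing to \<open>0\<close>. Continuity of
  scalar multiplication is the special case \<open>\<bar>u\<bar> / n \<down> 0\<close>.\<close>

section \<open>Vector lattices\<close>

lemma isLub_UNIV_iff:
  fixes A :: "'a::order set"
  shows "isLub UNIV A s \<longleftrightarrow> (\<forall>x\<in>A. x \<le> s) \<and> (\<forall>b. (\<forall>x\<in>A. x \<le> b) \<longrightarrow> s \<le> b)"
  by (auto simp: isLub_def leastP_def isUb_def setle_def setge_def)

lemma isGlb_UNIV_iff:
  fixes A :: "'a::order set"
  shows "isGlb UNIV A s \<longleftrightarrow> (\<forall>x\<in>A. s \<le> x) \<and> (\<forall>b. (\<forall>x\<in>A. b \<le> x) \<longrightarrow> b \<le> s)"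
  by (auto simp: isGlb_def greatestP_def isLb_def setle_def setge_def)

text \<open>By distributivity the right-hand side is the infimum of four sums. The sum of the two
  moduli dominates \<open>\<bar>a + b\<bar>\<close>, and each of the other three contains
  \<open>e\<close> plus a nonnegative term.\<close>

lemma inf_abs_add_le:
  fixes a b e :: "'a::vector_lattice"
  assumes "0 \<le> e"
  shows "inf \<bar>a + b\<bar> e \<le> inf \<bar>a\<bar> e + inf \<bar>b\<bar> e"
proof -
  have "\<bar>a + b\<bar> \<le> \<bar>a\<bar> + \<bar>b\<bar>" "e \<le> \<bar>a\<bar> + e" "e \<le> e + \<bar>b\<bar>" "e \<le> e + e"
    using assms by (simp_all add: abs_triangle_ineq)
  then have "inf \<bar>a + b\<bar> e \<le> inf (inf (\<bar>a\<bar> + \<bar>b\<bar>) (e + \<bar>b\<bar>)) (inf (\<bar>a\<bar> + e) (e + e))"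
    by (meson inf.cobounded1 inf.cobounded2 le_inf_iff order_trans)
  then show ?thesis
    by (simp add: add_inf_distrib_left add_inf_distrib_right)
qed

lemma abs_scaleR_le:
  fixes x :: "'a::vector_lattice"
  shows "\<bar>c *\<^sub>R x\<bar> \<le> \<bar>c\<bar> *\<^sub>R \<bar>x\<bar>"
proof -
  have *: "\<bar>c *\<^sub>R x\<bar> \<le> c *\<^sub>R \<bar>x\<bar>" if "0 \<le> c" for c :: real and x :: 'a
  proof (rule abs_leI)
    show "c *\<^sub>R x \<le> c *\<^sub>R \<bar>x\<bar>"
      using that by (intro scaleR_left_mono abs_ge_self)
    have "c *\<^sub>R (- x) \<le> c *\<^sub>R \<bar>x\<bar>"
      using that by (intro scaleR_left_mono abs_ge_minus_self)
    then show "- (c *\<^sub>R x) \<le> c *\<^sub>R \<bar>x\<bar>" by simp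
  qed
  show ?thesis
    using *[of c x] *[of "- c" x] by (cases "0 \<le> c") auto
qed

text \<open>The multiples of \<open>b\<close> have a supremum \<open>s\<close>. Passing from
  \<open>n\<close> to \<open>Suc n\<close> shows that \<open>s - b\<close> bounds them too, so
  \<open>s \<le> s - b\<close>.\<close>

lemma dedekind_complete_archimedean:
  fixes b u :: "'a::vector_lattice"
  assumes "dedekind_complete TYPE('a)" and le: "\<And>n. real n *\<^sub>R b \<le> u"
  shows "b \<le> 0"
proof -
  let ?A = "range (\<lambda>n. real n *\<^sub>R b)"
  have "bdd_above ?A"
    using le by (auto intro!: bdd_aboveI)
  then obtain s where s: "isLub UNIV ?A s"
    using assms(1) unfolding dedekind_complete_def by blast
  have "real n *\<^sub>R b \<le> s - b" for n
  proof -
    have "real (Suc n) *\<^sub>R b \<le> s"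
      using s unfolding isLub_UNIV_iff by blast
    then show ?thesis
      by (simp add: algebra_simps)
  qed
  then have "s \<le> s - b"
    using s unfolding isLub_UNIV_iff by blast
  then show ?thesis
    by (metis add_le_same_cancel1 diff_add_cancel le_diff_eq)
qed

lemma positive_functional_mono:
  assumes "positive_functional \<phi>" and "x \<le> y"
  shows "\<phi> x \<le> \<phi> y"
proof -
  have "0 \<le> \<phi> (y - x)"
    using assms unfolding positive_functional_def by simp
  then show ?thesis
    using assms(1) unfolding positive_functional_def by (simp add: linear_diff)
qed

section \<open>Banach lattices with order continuous norm\<close>

lemma norm_abs_banach_lattice: "norm \<bar>x\<bar> = norm (x :: 'a::banach_lattice)"
  by (intro antisym norm_mono_abs) simp_all

lemma order_continuous_norm_decseq:
  fixes x :: "nat \<Rightarrow> 'a::banach_lattice"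
  assumes "order_continuous_norm TYPE('a)" and "decseq x" and "isGlb UNIV (range x) 0"
  shows "x \<longlonglongrightarrow> 0"
proof -
  have "directed_preorder (UNIV :: nat set) (\<le>)"
    unfolding directed_preorder_def by (auto intro: order_trans max.cobounded1 max.cobounded2)
  moreover have "net_decreases_to_zero UNIV (\<le>) x"
    using assms(2,3) unfolding net_decreases_to_zero_def by (simp add: decseq_def)
  ultimately have "net_norm_tendsto_zero UNIV (\<le>) x"
    by (rule order_continuous_norm_net[OF assms(1)])
  then show ?thesis
    unfolding net_norm_tendsto_zero_def LIMSEQ_iff by simp
qed

text \<open>This upgrades suprema of countable sets to suprema of arbitrary bounded sup-closed sets.
  A sequence \<open>y\<close> in \<open>A\<close> along which \<open>\<phi>\<close> approaches its
  supremum over \<open>A\<close> has a supremum \<open>s\<close>; the excess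
  \<open>sup x s - s\<close> of any \<open>x\<close> in \<open>A\<close> has
  \<open>\<phi>\<close>-value at most 0, so strict positivity forces it to vanish.\<close>

lemma directed_has_Lub:
  fixes A :: "'a::banach_lattice set" and \<phi> :: "'a \<Rightarrow> real"
  assumes "dedekind_sigma_complete TYPE('a)" and "order_continuous_norm TYPE('a)"
    and "bounded_linear \<phi>" and pos: "positive_functional \<phi>" and "strictly_positive \<phi>"
    and "A \<noteq> {}" and "bdd_above A" and sup_closed: "\<And>x y. x \<in> A \<Longrightarrow> y \<in> A \<Longrightarrow> sup x y \<in> A"
  shows "\<exists>s. isLub UNIV A s"
proof -
  note mono = positive_functional_mono[OF pos]
  define M where "M = Sup (\<phi> ` A)"
  have bdd: "bdd_above (\<phi> ` A)"
    using assms(7) mono by (auto simp: bdd_above_def)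
  have approx: "\<exists>a\<in>A. M - 1 / real (Suc n) < \<phi> a" for n
    using less_cSup_iff[of "\<phi> ` A" "M - 1 / real (Suc n)"] bdd assms(6) by (auto simp: M_def)
  \<comment> \<open>Joining each almost maximal element to the previous term makes the sequence
    increasing; closure under \<open>sup\<close> and monotonicity of \<open>\<phi>\<close> preserve
    the other two properties.\<close>
  have "\<exists>y. \<forall>n. (y n \<in> A \<and> M - 1 / real (Suc n) < \<phi> (y n)) \<and> y n \<le> y (Suc n)"
  proof (rule dependent_nat_choice)
    show "\<exists>x. x \<in> A \<and> M - 1 / real (Suc 0) < \<phi> x"
      using approx by blast
    fix x n assume x: "x \<in> A \<and> M - 1 / real (Suc n) < \<phi> x"
    obtain a where "a \<in> A" "M - 1 / real (Suc (Suc n)) < \<phi> a"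
      using approx by blast
    moreover from this(2) have "M - 1 / real (Suc (Suc n)) < \<phi> (sup x a)"
      using mono[OF sup_ge2[of a x]] by (rule less_le_trans)
    ultimately show "\<exists>y. (y \<in> A \<and> M - 1 / real (Suc (Suc n)) < \<phi> y) \<and> x \<le> y"
      using x by (intro exI[of _ "sup x a"]) (auto intro: sup_closed)
  qed
  then obtain y where yA: "\<And>n. y n \<in> A" and yM: "\<And>n. M - 1 / real (Suc n) < \<phi> (y n)"
    and y_step: "\<And>n. y n \<le> y (Suc n)"
    by blast
  have "incseq y"
    using y_step by (rule incseq_SucI)
  have "countable (range y)"
    by simp
  moreover have "bdd_above (range y)"
    using assms(7) by (rule bdd_above_mono) (use yA in auto)
  ultimately obtain s where s: "isLub UNIV (range y) s"
    using assms(1) unfolding dedekind_sigma_complete_def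
    by blast
  have "isGlb UNIV (range (\<lambda>n. s - y n)) 0"
    unfolding isGlb_UNIV_iff
  proof (intro conjI allI impI)
    show "\<forall>x\<in>range (\<lambda>n. s - y n). 0 \<le> x"
      using s unfolding isLub_UNIV_iff by auto
    fix b assume "\<forall>x\<in>range (\<lambda>n. s - y n). b \<le> x"
    then have "\<forall>x\<in>range y. x \<le> s - b"
      by (auto simp: algebra_simps)
    then have "s \<le> s - b"
      using s unfolding isLub_UNIV_iff by blast
    then show "b \<le> 0"
      by (metis add_le_same_cancel1 diff_add_cancel le_diff_eq)
  qed
  moreover have "decseq (\<lambda>n. s - y n)"
    using \<open>incseq y\<close> by (auto simp: decseq_def incseq_def)
  ultimately have "(\<lambda>n. s - y n) \<longlonglongrightarrow> 0"
    using order_continuous_norm_decseq[OF assms(2)] by blast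
  then have lim: "(\<lambda>n. \<phi> (s - y n)) \<longlonglongrightarrow> 0"
    using bounded_linear.tendsto_zero[OF assms(3)] by blast
  have "x \<le> s" if "x \<in> A" for x
  proof -
    \<comment> \<open>Since \<open>y n \<le> s\<close>, the excess of \<open>x\<close> over
      \<open>s\<close> is at most its excess over \<open>y n\<close>. The join
      \<open>sup x (y n)\<close> is still in \<open>A\<close>, so its \<open>\<phi>\<close>-value is
      at most \<open>M\<close>, which exceeds \<open>\<phi> (y n)\<close> by less than
      \<open>1 / real (Suc n)\<close>. The added term is nonnegative and also tends to 0.\<close>
    have est: "\<phi> (sup x s - s) \<le> 1 / real (Suc n) + \<phi> (s - y n)" for n
    proof -
      have "\<phi> (sup x (y n)) \<le> M"
        using bdd sup_closed[OF that yA] unfolding M_def by (intro cSup_upper) auto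
      then have 1: "\<phi> (sup x (y n)) \<le> 1 / real (Suc n) + \<phi> (y n)"
        using yM[of n] by linarith
      have "y n \<le> s"
        using s unfolding isLub_UNIV_iff by blast
      then have "s \<le> sup x (y n) + (s - y n)" "x \<le> sup x (y n) + (s - y n)"
        by (metis add.commute add_right_mono diff_add_cancel sup_ge2,
            metis add_increasing2 diff_ge_0_iff_ge sup_ge1)
      then have "sup x s \<le> sup x (y n) + (s - y n)"
        by simp
      then have "sup x s - s \<le> sup x (y n) - y n"
        by (simp add: algebra_simps)
      then have "\<phi> (sup x s - s) \<le> \<phi> (sup x (y n) - y n)"
        by (rule mono)
      also have "\<dots> = \<phi> (sup x (y n)) - \<phi> (y n)"
        using assms(3) by (simp add: linear_diff bounded_linear.linear)
      finally have "\<phi> (sup x s - s) \<le> 1 / real (Suc n)"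
        using 1 by simp
      moreover have "0 \<le> \<phi> (s - y n)"
        using pos \<open>y n \<le> s\<close> unfolding positive_functional_def by simp
      ultimately show ?thesis by simp
    qed
    have "(\<lambda>n. 1 / real (Suc n) + \<phi> (s - y n)) \<longlonglongrightarrow> 0"
      using tendsto_add[OF LIMSEQ_inverse_real_of_nat lim] by (simp add: inverse_eq_divide)
    then have "\<phi> (sup x s - s) \<le> 0"
      using est by (intro LIMSEQ_le_const) auto
    then have "\<not> 0 < sup x s - s"
      using assms(5) unfolding strictly_positive_def by (meson not_le)
    then have "sup x s = s"
      by (metis diff_ge_0_iff_ge less_le right_minus_eq sup_ge2)
    then show ?thesis
      by (simp add: le_iff_sup)
  qed
  moreover have "s \<le> b" if "\<forall>x\<in>A. x \<le> b" for b
    using s that yA unfolding isLub_UNIV_iff by blast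
  ultimately show ?thesis
    unfolding isLub_UNIV_iff by blast
qed

section \<open>The gauge on the universal completion\<close>

locale completed_banach_lattice =
  fixes \<iota> :: "'e::banach_lattice \<Rightarrow> 'u::vector_lattice"
    and e :: 'e
    and \<phi> :: "'e \<Rightarrow> real"
  assumes sigma_complete: "dedekind_sigma_complete TYPE('e)"
    and oc_norm: "order_continuous_norm TYPE('e)"
    and unit: "weak_unit e"
    and bounded: "bounded_linear \<phi>"
    and positive: "positive_functional \<phi>"
    and strict: "strictly_positive \<phi>"
    and completion: "universal_completion \<iota>"
begin

section \<open>The embedding and the order interval below the unit\<close>

lemma linear_emb: "linear \<iota>" and inj_emb: "inj \<iota>"
  and emb_sup: "\<iota> (sup x y) = sup (\<iota> x) (\<iota> y)" and emb_inf: "\<iota> (inf x y) = inf (\<iota> x) (\<iota> y)"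
  using completion unfolding universal_completion_def vector_lattice_embedding_def by auto

lemma emb_dense: "0 < u \<Longrightarrow> \<exists>y. 0 < \<iota> y \<and> \<iota> y \<le> u"
  using completion unfolding universal_completion_def by blast

lemma emb_0 [simp]: "\<iota> 0 = 0"
  by (rule linear_0[OF linear_emb])

lemma emb_le_iff [simp]: "\<iota> x \<le> \<iota> y \<longleftrightarrow> x \<le> y"
  by (metis emb_sup inj_emb injD le_iff_sup)

lemma emb_nonneg_iff [simp]: "0 \<le> \<iota> x \<longleftrightarrow> 0 \<le> x"
  by (metis emb_0 emb_le_iff)

lemma emb_nonpos_iff [simp]: "\<iota> x \<le> 0 \<longleftrightarrow> x \<le> 0"
  by (metis emb_0 emb_le_iff)

lemma emb_pos_iff [simp]: "0 < \<iota> x \<longleftrightarrow> 0 < x"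
  by (simp add: less_le_not_le)

lemma emb_abs: "\<iota> \<bar>x\<bar> = \<bar>\<iota> x\<bar>"
  by (simp add: abs_lattice emb_sup linear_neg[OF linear_emb])

lemma e_nonneg: "0 \<le> e"
  using unit unfolding weak_unit_def by blast

text \<open>The supremum \<open>s\<close> of the positive elements of \<open>E\<close> below
  \<open>g\<close> is formed in \<open>E\<close>, and \<open>\<iota>\<close> is only known to
  respect finite suprema. Order density closes the gap: any failure of \<open>\<iota> s = g\<close>
  leaves room for a positive element of \<open>E\<close> by which \<open>s\<close> could be lowered
  or raised.\<close>

lemma unit_interval_subset: "{0..\<iota> e} \<subseteq> range \<iota>"
proof
  fix g assume "g \<in> {0..\<iota> e}"
  then have g: "0 \<le> g" "g \<le> \<iota> e" by auto
  define D where "D = {y. 0 \<le> y \<and> \<iota> y \<le> g}"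
  have "\<exists>s. isLub UNIV D s"
  proof (rule directed_has_Lub[OF sigma_complete oc_norm bounded positive strict])
    show "D \<noteq> {}"
      using g by (auto simp: D_def intro!: exI[of _ 0])
    have "y \<le> e" if "y \<in> D" for y
      using that g order_trans[of "\<iota> y" g "\<iota> e"] by (simp add: D_def)
    then show "bdd_above D" by (rule bdd_aboveI)
    show "sup x y \<in> D" if "x \<in> D" "y \<in> D" for x y
      using that by (auto simp: D_def emb_sup intro: le_supI1)
  qed
  then obtain s where ub: "\<And>y. y \<in> D \<Longrightarrow> y \<le> s" and least: "\<And>b. (\<And>y. y \<in> D \<Longrightarrow> y \<le> b) \<Longrightarrow> s \<le> b"
    unfolding isLub_UNIV_iff by blast
  have "\<iota> s \<le> g"
  proof (rule ccontr)
    assume "\<not> \<iota> s \<le> g"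
    \<comment> \<open>This difference is the positive part of \<open>\<iota> s - g\<close>. An
      element \<open>y\<close> of \<open>E\<close> below it makes \<open>s - y\<close> an upper
      bound of \<open>D\<close>, because the image of each member of \<open>D\<close> lies below
      both \<open>\<iota> s\<close> and \<open>g\<close>.\<close>
    then have "0 < \<iota> s - inf (\<iota> s) g"
      by (metis diff_gt_0_iff_gt inf.cobounded1 inf.orderI less_le)
    then obtain y where y: "0 < \<iota> y" "\<iota> y \<le> \<iota> s - inf (\<iota> s) g"
      using emb_dense by blast
    have "s \<le> s - y"
    proof (rule least)
      fix d assume d: "d \<in> D"
      then have "\<iota> d \<le> inf (\<iota> s) g"
        using ub by (simp add: D_def)
      also have "\<dots> \<le> \<iota> s - \<iota> y"
        using y(2) by (metis add.commute le_diff_eq)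
      also have "\<dots> = \<iota> (s - y)"
        by (simp add: linear_diff[OF linear_emb])
      finally show "d \<le> s - y" by simp
    qed
    moreover have "s - y < s"
      using y(1) by simp
    ultimately show False
      by (simp add: less_le_not_le)
  qed
  \<comment> \<open>A positive \<open>y\<close> of \<open>E\<close> in this gap would put
    \<open>s + y\<close> into \<open>D\<close>, above its own supremum.\<close>
  moreover have "\<not> 0 < g - \<iota> s"
  proof
    assume "0 < g - \<iota> s"
    then obtain y where y: "0 < \<iota> y" "\<iota> y \<le> g - \<iota> s"
      using emb_dense by blast
    have "0 \<le> s"
      using ub[of 0] g by (simp add: D_def)
    moreover have "\<iota> (s + y) \<le> g"
      using y(2) by (simp add: linear_add[OF linear_emb] algebra_simps)
    ultimately have "s + y \<in> D"
      using y(1) by (simp add: D_def)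
    then have "s + y \<le> s" by (rule ub)
    moreover have "s < s + y"
      using y(1) by simp
    ultimately show False
      by (simp add: less_le_not_le)
  qed
  ultimately have "g = \<iota> s"
    by (metis diff_gt_0_iff_gt less_le)
  then show "g \<in> range \<iota>" by blast
qed

section \<open>Truncation at the unit and the gauge\<close>

definition trunc :: "'u \<Rightarrow> 'e" where
  "trunc u = the_inv \<iota> (inf \<bar>u\<bar> (\<iota> e))"

definition gauge :: "'u \<Rightarrow> real" where
  "gauge u = \<phi> (trunc u)"

text \<open>Translation invariance reduces every metric statement to one about distances from
  0.\<close>

lemma d_phi_eq: "d_phi \<iota> e \<phi> f g = gauge (f - g)"
  by (simp add: d_phi_def gauge_def trunc_def)

text \<open>\<open>the_inv\<close> is meaningful only on the range of \<open>\<iota>\<close>, and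
  the interval inclusion puts the truncated modulus there. Inequalities for \<open>trunc\<close> can
  then be checked after applying \<open>\<iota>\<close>.\<close>

lemma emb_trunc [simp]: "\<iota> (trunc u) = inf \<bar>u\<bar> (\<iota> e)"
proof -
  have "inf \<bar>u\<bar> (\<iota> e) \<in> {0..\<iota> e}"
    using e_nonneg by simp
  then show ?thesis
    unfolding trunc_def using unit_interval_subset by (intro f_the_inv_into_f[OF inj_emb]) blast
qed

lemma trunc_nonneg: "0 \<le> trunc u"
  using emb_nonneg_iff[of "trunc u"] e_nonneg by simp

lemma trunc_mono: "\<bar>u\<bar> \<le> \<bar>v\<bar> \<Longrightarrow> trunc u \<le> trunc v"
  using emb_le_iff[of "trunc u" "trunc v"] by (simp add: le_infI1)

lemma trunc_add_le: "trunc (u + v) \<le> trunc u + trunc v"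
proof -
  have "\<iota> (trunc (u + v)) \<le> \<iota> (trunc u + trunc v)"
    using e_nonneg by (simp add: linear_add[OF linear_emb] inf_abs_add_le)
  then show ?thesis
    unfolding emb_le_iff .
qed

text \<open>The weak unit property concerns elements of \<open>E\<close> only, so a nonzero
  \<open>\<bar>u\<bar>\<close> is first replaced by a positive element of \<open>E\<close> below it,
  supplied by order density.\<close>

lemma trunc_eq_0:
  assumes "trunc u = 0"
  shows "u = 0"
proof (rule ccontr)
  assume "u \<noteq> 0"
  then have "0 < \<bar>u\<bar>" by simp
  then obtain y where y: "0 < \<iota> y" "\<iota> y \<le> \<bar>u\<bar>"
    using emb_dense by blast
  have "\<iota> (inf y e) \<le> \<iota> (trunc u)"
    using y(2) by (simp add: emb_inf le_infI1)
  then have "inf y e \<le> 0"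
    using assms by simp
  moreover have "0 \<le> inf y e"
    using y(1) e_nonneg by (simp add: less_imp_le)
  ultimately have "inf y e = 0" by (rule antisym)
  then show False
    using unit y(1) unfolding weak_unit_def by (auto simp: less_le)
qed

lemma gauge_nonneg: "0 \<le> gauge u"
  using positive trunc_nonneg unfolding gauge_def positive_functional_def by blast

lemma gauge_mono: "\<bar>u\<bar> \<le> \<bar>v\<bar> \<Longrightarrow> gauge u \<le> gauge v"
  unfolding gauge_def by (intro positive_functional_mono[OF positive] trunc_mono)

lemma gauge_add_le: "gauge (u + v) \<le> gauge u + gauge v"
proof -
  have "gauge (u + v) \<le> \<phi> (trunc u + trunc v)"
    unfolding gauge_def by (intro positive_functional_mono[OF positive] trunc_add_le)
  then show ?thesis
    using bounded by (simp add: gauge_def linear_add bounded_linear.linear)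
qed

lemma gauge_eq_0_iff: "gauge u = 0 \<longleftrightarrow> u = 0"
proof
  assume "gauge u = 0"
  then have "\<not> 0 < trunc u"
    using strict unfolding gauge_def strictly_positive_def by force
  then have "trunc u = 0"
    using trunc_nonneg[of u] by (auto simp: less_le)
  then show "u = 0" by (rule trunc_eq_0)
next
  assume "u = 0"
  then have "trunc u \<le> 0"
    using emb_nonpos_iff[of "trunc u"] by (simp add: le_infI1)
  then have "trunc u = 0"
    using trunc_nonneg by (rule antisym)
  then show "gauge u = 0"
    using bounded by (simp add: gauge_def linear_0 bounded_linear.linear)
qed

lemma gauge_emb_le: "gauge (\<iota> x) \<le> \<phi> \<bar>x\<bar>"
proof -
  have "\<iota> (trunc (\<iota> x)) \<le> \<iota> \<bar>x\<bar>"
    by (simp only: emb_trunc emb_abs inf.cobounded1)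
  then show ?thesis
    unfolding gauge_def emb_le_iff by (rule positive_functional_mono[OF positive])
qed

text \<open>The truncations decrease to 0 already in \<open>E\<close>: a lower bound
  \<open>b\<close> of them satisfies \<open>\<iota> b \<le> x n\<close> for all \<open>n\<close>,
  hence \<open>\<iota> b \<le> 0\<close>. Order continuity makes them norm null, and
  \<open>\<phi>\<close> is norm continuous.\<close>

lemma gauge_tendsto_0:
  assumes "decseq x" and glb: "isGlb UNIV (range x) 0"
  shows "(\<lambda>n. gauge (x n)) \<longlonglongrightarrow> 0"
proof -
  have x_nonneg: "0 \<le> x n" for n
    using glb unfolding isGlb_UNIV_iff by blast
  have "decseq (\<lambda>n. trunc (x n))"
    using assms(1) x_nonneg by (auto simp: decseq_def intro!: trunc_mono)
  moreover have "isGlb UNIV (range (\<lambda>n. trunc (x n))) 0"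
    unfolding isGlb_UNIV_iff
  proof (intro conjI allI impI)
    show "\<forall>y\<in>range (\<lambda>n. trunc (x n)). 0 \<le> y"
      using trunc_nonneg by blast
    fix b assume b: "\<forall>y\<in>range (\<lambda>n. trunc (x n)). b \<le> y"
    have "\<iota> b \<le> x n" for n
    proof -
      have "\<iota> b \<le> \<iota> (trunc (x n))"
        using b by (subst emb_le_iff) blast
      then show ?thesis
        using x_nonneg[of n] by simp
    qed
    then have "\<iota> b \<le> 0"
      using glb unfolding isGlb_UNIV_iff by blast
    then show "b \<le> 0" by simp
  qed
  ultimately have "(\<lambda>n. trunc (x n)) \<longlonglongrightarrow> 0"
    using order_continuous_norm_decseq[OF oc_norm] by blast
  then show ?thesis
    unfolding gauge_def using bounded_linear.tendsto_zero[OF bounded] by blast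
qed

section \<open>The gauge of scalar multiples\<close>

lemma gauge_of_nat_scaleR_le: "gauge (real n *\<^sub>R u) \<le> real n * gauge u"
proof (induction n)
  case 0
  then show ?case
    using gauge_eq_0_iff[of 0] by simp
next
  case (Suc n)
  have "gauge (u + real n *\<^sub>R u) \<le> gauge u + gauge (real n *\<^sub>R u)"
    by (rule gauge_add_le)
  then show ?case
    using Suc by (simp add: algebra_simps)
qed

lemma gauge_scaleR_mono:
  assumes "\<bar>c\<bar> \<le> r"
  shows "gauge (c *\<^sub>R u) \<le> gauge (r *\<^sub>R \<bar>u\<bar>)"
proof (rule gauge_mono)
  have "\<bar>c *\<^sub>R u\<bar> \<le> \<bar>c\<bar> *\<^sub>R \<bar>u\<bar>"
    by (rule abs_scaleR_le)
  also have "\<dots> \<le> r *\<^sub>R \<bar>u\<bar>"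
    using assms by (intro scaleR_right_mono) simp_all
  also have "\<dots> \<le> \<bar>r *\<^sub>R \<bar>u\<bar>\<bar>"
    by (rule abs_ge_self)
  finally show "\<bar>c *\<^sub>R u\<bar> \<le> \<bar>r *\<^sub>R \<bar>u\<bar>\<bar>" .
qed

lemma gauge_abs: "gauge \<bar>u\<bar> = gauge u"
  by (intro antisym gauge_mono) simp_all

text \<open>Truncation destroys homogeneity, so smallness for small scalars has to come from the
  order: the sequence decreases to 0 because the Dedekind complete space \<open>E^u\<close> is
  Archimedean.\<close>

lemma gauge_inverse_nat_tendsto_0: "(\<lambda>n. gauge (inverse (real (Suc n)) *\<^sub>R \<bar>u\<bar>)) \<longlonglongrightarrow> 0"
proof (rule gauge_tendsto_0)
  show "decseq (\<lambda>n. inverse (real (Suc n)) *\<^sub>R \<bar>u\<bar>)"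
    by (auto simp: decseq_def intro!: scaleR_right_mono le_imp_inverse_le)
  show "isGlb UNIV (range (\<lambda>n. inverse (real (Suc n)) *\<^sub>R \<bar>u\<bar>)) 0"
    unfolding isGlb_UNIV_iff
  proof (intro conjI allI impI)
    show "\<forall>x\<in>range (\<lambda>n. inverse (real (Suc n)) *\<^sub>R \<bar>u\<bar>). 0 \<le> x"
      by (auto intro!: scaleR_nonneg_nonneg)
    fix b assume b: "\<forall>x\<in>range (\<lambda>n. inverse (real (Suc n)) *\<^sub>R \<bar>u\<bar>). b \<le> x"
    have "real n *\<^sub>R b \<le> \<bar>u\<bar>" for n
    proof (cases n)
      case (Suc m)
      have "b \<le> inverse (real n) *\<^sub>R \<bar>u\<bar>"
        using b Suc by blast
      then have "real n *\<^sub>R b \<le> real n *\<^sub>R (inverse (real n) *\<^sub>R \<bar>u\<bar>)"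
        by (rule scaleR_left_mono) simp
      then show ?thesis
        using Suc by simp
    qed simp
    then show "b \<le> 0"
      using completion dedekind_complete_archimedean
      unfolding universal_completion_def universally_complete_def by blast
  qed
qed

section \<open>The metric and its topology\<close>

sublocale Metric_space UNIV "d_phi \<iota> e \<phi>"
proof
  fix x y z :: 'u
  show "0 \<le> d_phi \<iota> e \<phi> x y"
    by (simp add: d_phi_eq gauge_nonneg)
  show "d_phi \<iota> e \<phi> x y = d_phi \<iota> e \<phi> y x"
    unfolding d_phi_eq by (intro antisym gauge_mono) (simp_all add: abs_minus_commute)
  show "d_phi \<iota> e \<phi> x y = 0 \<longleftrightarrow> x = y"
    by (simp add: d_phi_eq gauge_eq_0_iff)
  show "d_phi \<iota> e \<phi> x z \<le> d_phi \<iota> e \<phi> x y + d_phi \<iota> e \<phi> y z"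
    using gauge_add_le[of "x - y" "y - z"] by (simp add: d_phi_eq)
qed

text \<open>This is the working form of ball membership; the general rule \<open>in_mball\<close>
  leaves the simpset afterwards so that balls unfold to the gauge.\<close>

lemma mem_mball_iff: "y \<in> mball x r \<longleftrightarrow> gauge (y - x) < r"
  using commute[of x y] by (simp add: d_phi_eq)

declare in_mball [simp del]

lemma emb_continuous: "continuous_map euclidean mtopology \<iota>"
  unfolding continuous_map_to_metric
proof (intro ballI allI impI)
  fix x :: 'e and r :: real assume "0 < r"
  obtain K where K: "0 < K" "\<And>x. norm (\<phi> x) \<le> norm x * K"
    using bounded_linear.pos_bounded[OF bounded] by blast
  \<comment> \<open>On the image of \<open>E\<close> the gauge is at most \<open>K\<close> times the
    norm, since \<open>\<phi>\<close> is bounded by \<open>K\<close> and the modulus has the same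
    norm; hence the radius \<open>r / K\<close>.\<close>
  have "\<iota> y \<in> mball (\<iota> x) r" if "y \<in> ball x (r / K)" for y
  proof -
    have "gauge (\<iota> y - \<iota> x) = gauge (\<iota> (y - x))"
      by (simp add: linear_diff[OF linear_emb])
    also have "\<dots> \<le> \<phi> \<bar>y - x\<bar>"
      by (rule gauge_emb_le)
    also have "\<dots> \<le> norm (y - x) * K"
      using K(2)[of "\<bar>y - x\<bar>"] by (simp add: norm_abs_banach_lattice)
    also have "\<dots> < r"
      using that K(1) by (simp add: dist_norm norm_minus_commute field_simps)
    finally show ?thesis
      by (simp add: mem_mball_iff)
  qed
  then show "\<exists>U. openin euclidean U \<and> x \<in> U \<and> (\<forall>y\<in>U. \<iota> y \<in> mball (\<iota> x) r)"
    using \<open>0 < r\<close> K(1) by (intro exI[of _ "ball x (r / K)"]) auto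
qed

lemma add_continuous: "continuous_map (prod_topology mtopology mtopology) mtopology (\<lambda>(x, y). x + y)"
  unfolding continuous_map_to_metric
proof (intro ballI allI impI)
  fix p :: "'u \<times> 'u" and r :: real assume "0 < r"
  obtain x y where p: "p = (x, y)" by (cases p)
  have "a + b \<in> mball (x + y) r" if "a \<in> mball x (r / 2)" "b \<in> mball y (r / 2)" for a b
    using that gauge_add_le[of "a - x" "b - y"] by (simp add: mem_mball_iff add_diff_add)
  then show "\<exists>U. openin (prod_topology mtopology mtopology) U \<and> p \<in> U \<and>
      (\<forall>q\<in>U. (case q of (x, y) \<Rightarrow> x + y) \<in> mball (case p of (x, y) \<Rightarrow> x + y) r)"
    using \<open>0 < r\<close>
    by (intro exI[of _ "mball x (r / 2) \<times> mball y (r / 2)"]) (auto simp: p openin_prod_Times_iff)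
qed

text \<open>The difference splits as \<open>b *\<^sub>R (y - x) + (b - c) *\<^sub>R x\<close>.
  Subadditivity controls the first summand for bounded \<open>b\<close>, and the null sequence of
  multiples of \<open>\<bar>x\<bar>\<close> controls the second.\<close>

lemma scaleR_continuous:
  "continuous_map (prod_topology euclideanreal mtopology) mtopology (\<lambda>(c, x). c *\<^sub>R x)"
  unfolding continuous_map_to_metric
proof (intro ballI allI impI)
  fix p :: "real \<times> 'u" and r :: real assume "0 < r"
  obtain c x where p: "p = (c, x)" by (cases p)
  \<comment> \<open>As \<open>\<delta> \<le> 1\<close> below, \<open>N\<close> bounds
    \<open>\<bar>b\<bar>\<close> for every \<open>b\<close> within \<open>\<delta>\<close> of
    \<open>c\<close>. It is a natural number because subadditivity lets only such factors out of the
    gauge; the radius \<open>r / (2 * real N)\<close> compensates for it.\<close>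
  obtain N :: nat where N: "\<bar>c\<bar> + 1 \<le> real N"
    using real_arch_simple by blast
  have "0 < real N"
    using N abs_ge_zero[of c] by linarith
  obtain n where n: "gauge (inverse (real (Suc n)) *\<^sub>R \<bar>x\<bar>) < r / 2"
    using order_tendstoD(2)[OF gauge_inverse_nat_tendsto_0[of x], of "r / 2"] \<open>0 < r\<close>
    by (auto simp: eventually_sequentially)
  define \<delta> where "\<delta> = inverse (real (Suc n))"
  have \<delta>: "0 < \<delta>" "\<delta> \<le> 1"
    by (simp_all add: \<delta>_def field_simps)
  have "b *\<^sub>R y \<in> mball (c *\<^sub>R x) r" if b: "b \<in> ball c \<delta>" and y: "y \<in> mball x (r / (2 * real N))" for b y
  proof -
    have "\<bar>b - c\<bar> \<le> \<delta>" "\<bar>b\<bar> \<le> real N"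
      using b \<delta>(2) N by (auto simp: dist_real_def)
    have "gauge (b *\<^sub>R (y - x)) \<le> gauge (real N *\<^sub>R \<bar>y - x\<bar>)"
      using \<open>\<bar>b\<bar> \<le> real N\<close> by (rule gauge_scaleR_mono)
    also have "\<dots> \<le> real N * gauge (y - x)"
      using gauge_of_nat_scaleR_le[of N "\<bar>y - x\<bar>"] by (simp add: gauge_abs)
    also have "\<dots> < r / 2"
      using y \<open>0 < real N\<close> by (simp add: mem_mball_iff field_simps)
    finally have "gauge (b *\<^sub>R (y - x)) < r / 2" .
    moreover have "gauge ((b - c) *\<^sub>R x) < r / 2"
      using gauge_scaleR_mono[OF \<open>\<bar>b - c\<bar> \<le> \<delta>\<close>, of x] n by (simp add: \<delta>_def)
    moreover have "b *\<^sub>R y - c *\<^sub>R x = b *\<^sub>R (y - x) + (b - c) *\<^sub>R x"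
      by (simp add: algebra_simps)
    ultimately show ?thesis
      using gauge_add_le[of "b *\<^sub>R (y - x)" "(b - c) *\<^sub>R x"] by (simp add: mem_mball_iff)
  qed
  then show "\<exists>U. openin (prod_topology euclideanreal mtopology) U \<and> p \<in> U \<and>
      (\<forall>q\<in>U. (case q of (c, x) \<Rightarrow> c *\<^sub>R x) \<in> mball (case p of (c, x) \<Rightarrow> c *\<^sub>R x) r)"
    using \<open>0 < r\<close> \<open>0 < real N\<close> \<delta>(1)
    by (intro exI[of _ "ball c \<delta> \<times> mball x (r / (2 * real N))"])
       (auto simp: p openin_prod_Times_iff)
qed

lemma mtopology_locally_solid: "locally_solid mtopology"
  unfolding locally_solid_def
proof (intro conjI allI impI)
  show "linear_topology mtopology"
    unfolding linear_topology_def using add_continuous scaleR_continuous by simp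
  fix U assume "openin mtopology U \<and> 0 \<in> U"
  then obtain r where r: "0 < r" "mball 0 r \<subseteq> U"
    unfolding openin_mtopology by blast
  \<comment> \<open>The gauge is monotone in the modulus, so the ball around 0 is itself solid and
    serves as both \<open>V\<close> and \<open>W\<close>.\<close>
  have "solid (mball 0 r)"
    unfolding solid_def by (auto simp: mem_mball_iff intro: le_less_trans gauge_mono)
  then show "\<exists>V W. openin mtopology W \<and> 0 \<in> W \<and> W \<subseteq> V \<and> V \<subseteq> U \<and> solid V"
    using r by (intro exI[of _ "mball 0 r"]) auto
qed

lemma mtopology_sigma_Lebesgue: "sigma_Lebesgue mtopology"
  unfolding sigma_Lebesgue_def
proof (intro allI impI)
  fix x :: "nat \<Rightarrow> 'u" assume "decseq x \<and> isGlb UNIV (range x) 0"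
  then have "(\<lambda>n. gauge (x n)) \<longlonglongrightarrow> 0"
    using gauge_tendsto_0 by blast
  then show "limitin mtopology x 0 sequentially"
    using order_tendstoD(2) by (fastforce simp: limitin_metric d_phi_eq)
qed

end

text \<open>The first conjunct records that \<open>d_phi\<close> is well defined. Boundedness
  together with positivity expresses that \<open>\<phi>\<close> lies in the positive cone of the
  norm dual.\<close>

theorem proposition3p6:
  fixes \<iota> :: "'e::banach_lattice \<Rightarrow> 'u::vector_lattice"
    and e :: 'e
    and \<phi> :: "'e \<Rightarrow> real"
  assumes "dedekind_sigma_complete TYPE('e)"
    and "order_continuous_norm TYPE('e)"
    and "weak_unit e"
    and "bounded_linear \<phi>" and "positive_functional \<phi>" and "strictly_positive \<phi>"
    and "universal_completion \<iota>"
  shows "{0..\<iota> e} \<subseteq> range \<iota> \<and>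
    Metric_space UNIV (d_phi \<iota> e \<phi>) \<and>
    continuous_map euclidean (Metric_space.mtopology UNIV (d_phi \<iota> e \<phi>)) \<iota> \<and>
    locally_solid (Metric_space.mtopology UNIV (d_phi \<iota> e \<phi>)) \<and>
    sigma_Lebesgue (Metric_space.mtopology UNIV (d_phi \<iota> e \<phi>))"
proof -
  interpret completed_banach_lattice \<iota> e \<phi>
    using assms by (rule completed_banach_lattice.intro)
  show ?thesis
    using unit_interval_subset Metric_space_axioms emb_continuous mtopology_locally_solid
      mtopology_sigma_Lebesgue by blast
qed

end
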